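(* The family $\mathfrak{A}:=\{\mathfrak{A}_s^t:\ s\in[0,\infty),\ t\in[0,1]\}$, partially ordered by inclusion, is not a lattice.
   Context: Let $\mathbb{D}=\{z\in\mathbb{C}:|z|<1\}$ and let $\mathcal{A}$ be the set of all holomorphic functions $f$ on $\mathbb{D}$ with $f(0)=0$ and $f'(0)=1$. For $s\in[0,\infty)$ and $t\in[0,1]$ define $$\mathfrak{A}_s^t:=\left\{f\in\mathcal{A}:\ \Re\left[(s-1)\frac{f(z)}{z}+f'(z)\right]\ge st\ \text{ for all } z\in\mathbb{D}\setminus\{0\}\right\}.$$ A family of sets $\mathfrak{G}$ partially ordered by $\subset$ is a lattice if each pair $\mathfrak{G}_1,\mathfrak{G}_2\in\mathfrak{G}$ has a (unique) supremum and a (unique) infimum in $\mathfrak{G}$. Here the supremum is an element $\mathfrak{S}\in\mathfrak{G}$ with $\mathfrak{G}_1\cup\mathfrak{G}_2\subset\mathfrak{S}$ such that $\mathfrak{G}_1\cup\mathfrak{G}_2\subset\mathfrak{G}_*\in\mathfrak{G}$ implies $\mathfrak{S}\subset\mathfrak{G}_*$; the infimum is an element $\mathfrak{I}\in\mathfrak{G}$ with $\mathfrak{I}\subset\mathfrak{G}_1\cap\mathfrak{G}_2$ such that $\mathfrak{G}_*\in\mathfrak{G}$, $\mathfrak{G}_*\subset\mathfrak{G}_1\cap\mathfrak{G}_2$ implies $\mathfrak{G}_*\subset\mathfrak{I}$. *)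

theory Defs
  imports "HOL-Complex_Analysis.Complex_Analysis" "HOL-Algebra.Lattice"
begin

text \<open>
  A holomorphic function on the unit disc is represented by a total function that is
  unconstrained outside the disc. All sets below depend only on the values on the disc, so
  inclusion between them is inclusion between the corresponding sets of functions on the disc.
\<close>

definition normalized_holomorphic :: "(complex \<Rightarrow> complex) set" where
  "normalized_holomorphic = {f. f holomorphic_on ball 0 1 \<and> f 0 = 0 \<and> deriv f 0 = 1}"

definition frakA :: "real \<Rightarrow> real \<Rightarrow> (complex \<Rightarrow> complex) set" where
  "frakA s t = {f \<in> normalized_holomorphic.
     \<forall>z \<in> ball 0 1 - {0}. Re ((of_real s - 1) * (f z / z) + deriv f z) \<ge> s * t}"

definition frakA_family :: "(complex \<Rightarrow> complex) set set" where
  "frakA_family = {frakA s t | s t. 0 \<le> s \<and> 0 \<le> t \<and> t \<le> 1}"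

definition inclusion_order :: "'a set set \<Rightarrow> 'a set gorder" where
  "inclusion_order F = \<lparr>carrier = F, eq = (=), le = (\<subseteq>)\<rparr>"

lemma partial_order_inclusion_order: "partial_order (inclusion_order F)"
  by unfold_locales (auto simp: inclusion_order_def)

text \<open>
  For a family of sets under inclusion, the locale \<^locale>\<open>lattice\<close> requires exactly a
  unique supremum and a unique infimum, within the family, of each pair of members.
\<close>

lemma lattice_inclusion_order_iff:
  "lattice (inclusion_order F) \<longleftrightarrow>
    (\<forall>A\<in>F. \<forall>B\<in>F.
      (\<exists>!S. S \<in> F \<and> A \<union> B \<subseteq> S \<and> (\<forall>T\<in>F. A \<union> B \<subseteq> T \<longrightarrow> S \<subseteq> T)) \<and>
      (\<exists>!I. I \<in> F \<and> I \<subseteq> A \<inter> B \<and> (\<forall>T\<in>F. T \<subseteq> A \<inter> B \<longrightarrow> T \<subseteq> I)))"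
    (is "?L \<longleftrightarrow> (\<forall>A\<in>F. \<forall>B\<in>F. (\<exists>!S. ?sup A B S) \<and> (\<exists>!I. ?inf A B I))")
proof -
  have carr: "carrier (inclusion_order F) = F"
    and le: "le (inclusion_order F) = (\<subseteq>)"
    by (simp_all add: inclusion_order_def)
  have Upper: "Upper (inclusion_order F) {A, B} = {T \<in> F. A \<union> B \<subseteq> T}"
    if "A \<in> F" "B \<in> F" for A B
  proof (rule Set.set_eqI)
    show "T \<in> Upper (inclusion_order F) {A, B} \<longleftrightarrow> T \<in> {T \<in> F. A \<union> B \<subseteq> T}" for T
      using that unfolding Upper_def carr le Un_subset_iff by fast
  qed
  have Lower: "Lower (inclusion_order F) {A, B} = {T \<in> F. T \<subseteq> A \<inter> B}"
    if "A \<in> F" "B \<in> F" for A B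
  proof (rule Set.set_eqI)
    show "T \<in> Lower (inclusion_order F) {A, B} \<longleftrightarrow> T \<in> {T \<in> F. T \<subseteq> A \<inter> B}" for T
      using that unfolding Lower_def carr le Int_subset_iff by fast
  qed
  have sup: "least (inclusion_order F) S (Upper (inclusion_order F) {A, B}) \<longleftrightarrow> ?sup A B S"
    if "A \<in> F" "B \<in> F" for A B S
    unfolding Upper[OF that] least_def carr le Ball_def mem_Collect_eq
    by (simp only: Collect_restrict imp_conjL conj_assoc simp_thms)
  have inf: "greatest (inclusion_order F) I (Lower (inclusion_order F) {A, B}) \<longleftrightarrow> ?inf A B I"
    if "A \<in> F" "B \<in> F" for A B I
    unfolding Lower[OF that] greatest_def carr le Ball_def mem_Collect_eq
    by (simp only: Collect_restrict imp_conjL conj_assoc simp_thms)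
  have sup_unique: "S = S'" if "?sup A B S" "?sup A B S'" for A B S S'
  proof (rule subset_antisym)
    show "S \<subseteq> S'" 
      using that(1)[THEN conjunct2, THEN conjunct2] that(2)
      by (elim conjE) (drule (1) bspec, erule (1) mp)
    show "S' \<subseteq> S" 
      using that(2)[THEN conjunct2, THEN conjunct2] that(1)
      by (elim conjE) (drule (1) bspec, erule (1) mp)
  qed
  have inf_unique: "I = I'" if "?inf A B I" "?inf A B I'" for A B I I'
  proof (rule subset_antisym)
    show "I' \<subseteq> I" 
      using that(1)[THEN conjunct2, THEN conjunct2] that(2)
      by (elim conjE) (drule (1) bspec, erule (1) mp)
    show "I \<subseteq> I'" 
      using that(2)[THEN conjunct2, THEN conjunct2] that(1)
      by (elim conjE) (drule (1) bspec, erule (1) mp)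
  qed
  have usup: "(\<exists>!S. ?sup A B S) \<longleftrightarrow> (\<exists>S. ?sup A B S)" for A B
    by (rule iffI, erule ex1_implies_ex, rule ex_ex1I, assumption, rule sup_unique)
  have uinf: "(\<exists>!I. ?inf A B I) \<longleftrightarrow> (\<exists>I. ?inf A B I)" for A B
    by (rule iffI, erule ex1_implies_ex, rule ex_ex1I, assumption, rule inf_unique)
  have "?L \<longleftrightarrow> (\<forall>A\<in>F. \<forall>B\<in>F.
      (\<exists>S. least (inclusion_order F) S (Upper (inclusion_order F) {A, B})) \<and>
      (\<exists>I. greatest (inclusion_order F) I (Lower (inclusion_order F) {A, B})))"
    using partial_order_inclusion_order[of F]
    unfolding lattice_def upper_semilattice_def lower_semilattice_def
      upper_semilattice_axioms_def lower_semilattice_axioms_def carr by fast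
  also have "\<dots> \<longleftrightarrow> (\<forall>A\<in>F. \<forall>B\<in>F. (\<exists>S. ?sup A B S) \<and> (\<exists>I. ?inf A B I))"
    by (intro ball_cong refl) (simp only: sup inf)
  finally show ?thesis
    unfolding usup uinf .
qed

end

theory Submission
  imports Defs "HOL-Real_Asymp.Real_Asymp"
begin

text \<open>
  Two members without a supremum are exhibited. Write \<open>f z = z F z\<close> and \<open>\<tau> = 1 - t\<close>. The class
  \<open>frakA s t\<close> then consists of the \<open>F\<close> with \<open>F 0 = 1\<close> and \<open>Re (s F + z F') \<ge> s t\<close>, and passing from
  \<open>s\<close> to \<open>s'\<close> adds \<open>(s' - s) F\<close> to the left-hand side. Everything is governed by the function
  \<open>extremal s\<close>, for which \<open>s F + z F' = s (1 + z) / (1 - z)\<close>. Let \<open>\<mu> s\<close> be its radial limit at -1.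
  For \<open>s > 0\<close> and \<open>\<tau> > 0\<close>, an inclusion of \<open>frakA s t\<close> in \<open>frakA s' t'\<close> holds exactly when \<open>s \<le> s'\<close> and

    \<open>\<tau> (s + (s' - s) (1 - \<mu> s)) \<le> s' \<tau>'\<close>.

  Sufficiency (\<open>frakA_subset\<close>): Harnack's inequality, integrated along radii, shows that \<open>Re F\<close>
  is minorized by the extremal function on the negative radius. Necessity of the inequality
  (\<open>frakA_subset_imp\<close>): the extremal function itself near -1. Necessity of \<open>s \<le> s'\<close>
  (\<open>frakA_subset_imp_index_le\<close>): the extremal function has a logarithmic singularity at 1, whereas
  \<open>Re (s F + z F')\<close> stays bounded along a horocycle at 1. Only \<open>s = 1\<close> and \<open>s = 2\<close> need explicit
  limits, namely \<open>\<mu> 1 = 2 L - 1\<close> and \<open>\<mu> 2 = 3 - 4 L\<close> with \<open>L = ln 2\<close>.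

  The criterion loses something when it is applied in two steps. The class \<open>frakA 1 0\<close> lies in a
  class with index 2 exactly when \<open>\<tau> \<ge> (3 - 2 L) / 2\<close>, and in a class with index 3 exactly when
  \<open>\<tau> \<ge> (5 - 4 L) / 3\<close>. A class with index 2 and parameter \<open>\<tau>\<close> lies in the smallest such class with
  index 3 exactly when \<open>\<tau> \<le> (5 - 4 L) / (4 L)\<close>. Because \<open>4 L\<^sup>2 - 10 L + 5 < 0\<close>, this threshold is
  smaller than \<open>(3 - 2 L) / 2\<close>.

  Take \<open>frakA 1 0\<close> and the class with index 2 and \<open>\<tau> = (5 - 4 L) / (4 L)\<close>. They have an upper bound
  of index 2, so their supremum would have index 2 and hence \<open>\<tau> \<ge> (3 - 2 L) / 2\<close>. But they also
  have the upper bound of index 3 with \<open>\<tau> = (5 - 4 L) / 3\<close>, which contains no such class.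
\<close>

section \<open>Harnack's inequality\<close>

text \<open>
  For \<open>c > 0\<close> and \<open>Re p > 0\<close>, the Cayley transform \<open>(p - c) / (p + c)\<close> maps the disc into itself
  and vanishes at the origin, so Schwarz's lemma bounds it by \<open>norm z\<close>; solving for \<open>Re p\<close> gives
  the estimate. Equality holds for \<open>p z = c (1 + z) / (1 - z)\<close> on the negative radius.
\<close>

lemma Re_ge_Harnack:
  assumes holp: "p holomorphic_on ball 0 1"
    and nonneg: "\<And>z. norm z < 1 \<Longrightarrow> Re (p z) \<ge> 0"
    and p0: "p 0 = of_real c" and z: "norm z < 1"
  shows "Re (p z) \<ge> c * (1 - norm z) / (1 + norm z)"
proof (rule field_le_epsilon)
  fix e :: real assume e: "e > 0"
  \<comment> \<open>Adding \<open>e\<close> makes the real part and the value at the origin strictly positive.\<close>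
  define q where "q = (\<lambda>z. p z + of_real e)"
  define d where "d = c + e"
  have c: "c \<ge> 0" using nonneg[of 0] p0 by simp
  have d: "d > 0" using c e by (simp add: d_def)
  have q_pos: "Re (q z) > 0" if "norm z < 1" for z
    using nonneg[OF that] e by (simp add: q_def)
  have *: "cmod (w - of_real d) < cmod (w + of_real d)" if "Re w > 0" for w
  proof -
    have "(cmod (w - of_real d))\<^sup>2 < (cmod (w + of_real d))\<^sup>2"
      using mult_pos_pos[OF that d] by (simp add: cmod_power2) (simp add: power2_eq_square algebra_simps)
    thus ?thesis using norm_ge_zero power2_less_imp_less by blast
  qed
  have nz: "q z + of_real d \<noteq> 0" if "norm z < 1" for z
    using *[OF q_pos[OF that]] by auto
  have "cmod ((q z - of_real d) / (q z + of_real d)) \<le> norm z"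
  proof (rule Schwarz_Lemma[where f = "\<lambda>z. (q z - of_real d) / (q z + of_real d)"])
    show "(\<lambda>z. (q z - of_real d) / (q z + of_real d)) holomorphic_on ball 0 1"
      using nz unfolding q_def by (intro holomorphic_intros holp) auto
    show "(q 0 - of_real d) / (q 0 + of_real d) = 0" by (simp add: q_def d_def p0)
    show "cmod ((q \<zeta> - of_real d) / (q \<zeta> + of_real d)) < 1" if "norm \<zeta> < 1" for \<zeta>
      using *[OF q_pos[OF that]] nz[OF that] by (simp add: norm_divide divide_simps)
  qed fact
  hence "cmod (q z - of_real d) \<le> norm z * cmod (q z + of_real d)"
    using nz[OF z] by (simp add: norm_divide divide_simps split: if_splits)
  hence "(cmod (q z - of_real d))\<^sup>2 \<le> (norm z)\<^sup>2 * (cmod (q z + of_real d))\<^sup>2"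
    using power_mono by (fastforce simp flip: power_mult_distrib)
  hence "(Re (q z) - d)\<^sup>2 + (Im (q z))\<^sup>2 \<le> (norm z)\<^sup>2 * ((Re (q z) + d)\<^sup>2 + (Im (q z))\<^sup>2)"
    by (simp add: cmod_power2)
  moreover have "(norm z)\<^sup>2 * (Im (q z))\<^sup>2 \<le> (Im (q z))\<^sup>2"
    using z by (intro mult_left_le_one_le) (auto simp: power_le_one)
  ultimately have "(Re (q z) - d)\<^sup>2 \<le> (norm z * (Re (q z) + d))\<^sup>2"
    unfolding power_mult_distrib by (simp add: distrib_left)
  hence "\<bar>Re (q z) - d\<bar> \<le> norm z * (Re (q z) + d)"
    using q_pos[OF z] d by (subst (asm) abs_le_square_iff[symmetric]) (simp add: abs_mult)
  hence "d * (1 - norm z) \<le> Re (q z) * (1 + norm z)"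
    by (simp add: algebra_simps abs_le_iff)
  moreover have "c * (1 - norm z) \<le> d * (1 - norm z)"
    using z e by (intro mult_right_mono) (auto simp: d_def)
  ultimately have "c * (1 - norm z) / (1 + norm z) \<le> Re (q z)"
    by (simp add: divide_simps add_pos_nonneg)
  thus "c * (1 - norm z) / (1 + norm z) \<le> Re (p z) + e" by (simp add: q_def)
qed

section \<open>The classes in terms of \<open>F z = f z / z\<close>\<close>

text \<open>
  Since \<open>f' = F + z F'\<close>, the expression in the definition of the class is \<open>s F + z F'\<close>. At the
  origin it equals \<open>s\<close>, which is at least \<open>s t\<close>, so the condition may be imposed on the whole disc.
\<close>

lemma frakA_iff:
  assumes holF: "F holomorphic_on ball 0 1" and f: "\<And>z. norm z < 1 \<Longrightarrow> f z = z * F z"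
    and "0 \<le> s" "t \<le> 1"
  shows "f \<in> frakA s t \<longleftrightarrow>
    F 0 = 1 \<and> (\<forall>z. norm z < 1 \<longrightarrow> Re (of_real s * F z + z * deriv F z) \<ge> s * t)"
proof -
  have der: "(f has_field_derivative F z + z * deriv F z) (at z)" if z: "norm z < 1" for z
  proof (rule has_field_derivative_transform_within_open[where S = "ball 0 1"])
    have "(F has_field_derivative deriv F z) (at z)"
      using z by (intro holomorphic_derivI[OF holF]) auto
    thus "((\<lambda>z. z * F z) has_field_derivative F z + z * deriv F z) (at z)"
      by (auto intro!: derivative_eq_intros)
  qed (use z f in auto)
  have holf: "f holomorphic_on ball 0 1"
    using der by (force simp: holomorphic_on_open)
  have d0: "deriv f 0 = F 0" using DERIV_imp_deriv[OF der[of 0]] by simp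
  have eq: "(of_real s - 1) * (f z / z) + deriv f z = of_real s * F z + z * deriv F z"
    if "norm z < 1" "z \<noteq> 0" for z
    using DERIV_imp_deriv[OF der[OF that(1)]] that f by (simp add: algebra_simps)
  have "s * t \<le> s" using assms(3,4) by (simp add: mult_left_le)
  hence "(\<forall>z\<in>ball 0 1 - {0}. Re ((of_real s - 1) * (f z / z) + deriv f z) \<ge> s * t) \<longleftrightarrow>
      (\<forall>z. norm z < 1 \<longrightarrow> Re (of_real s * F z + z * deriv F z) \<ge> s * t)" if "F 0 = 1"
    using that eq by (intro iffI allI ballI impI; case_tac "z = 0") auto
  moreover have "f \<in> normalized_holomorphic \<longleftrightarrow> F 0 = 1"
    using holf f[of 0] by (simp add: normalized_holomorphic_def d0)
  ultimately show ?thesis unfolding frakA_def by blast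
qed

lemma frakA_quotient:
  assumes "f \<in> frakA s t"
  obtains F where "F holomorphic_on ball 0 1" "\<And>z. norm z < 1 \<Longrightarrow> f z = z * F z"
proof -
  have "f holomorphic_on ball 0 1" "f 0 = 0"
    using assms by (auto simp: frakA_def normalized_holomorphic_def)
  thus ?thesis using Schwarz3 that by metis
qed

section \<open>The extremal function\<close>

text \<open>
  The Lerch transcendent \<open>\<Phi>(z, 1, s)\<close>. Multiplying its coefficients by \<open>s + n\<close> turns it into the
  geometric series, so it solves \<open>s y + z y' = 1 / (1 - z)\<close>.
\<close>

definition lerch :: "real \<Rightarrow> complex \<Rightarrow> complex" where
  "lerch s z = (\<Sum>n. z ^ n / of_real (s + real n))"

text \<open>
  The solution of \<open>s y + z y' = s (1 + z) / (1 - z)\<close> regular at the origin. In \<open>frakA s 0\<close> it is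
  the quotient \<open>f z / z\<close> that belongs to the half-plane map \<open>(1 + z) / (1 - z)\<close>.
\<close>

definition extremal :: "real \<Rightarrow> complex \<Rightarrow> complex" where
  "extremal s z = 2 * of_real s * lerch s z - 1"

lemma summable_lerch:
  assumes "s > 0" "norm z < 1"
  shows "summable (\<lambda>n. inverse (of_real (s + real n)) * z ^ n :: complex)"
proof (rule summable_comparison_test[OF _ summable_mult[OF summable_geometric]])
  have "norm (inverse (of_real (s + real n)) * z ^ n :: complex) \<le> inverse s * norm z ^ n" for n
    unfolding norm_mult norm_power norm_inverse norm_of_real
    using assms by (intro mult_right_mono) auto
  thus "\<exists>N. \<forall>n\<ge>N. norm (inverse (of_real (s + real n)) * z ^ n) \<le> inverse s * norm z ^ n"
    by blast
qed (use assms in simp)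

lemma lerch_ode:
  assumes "s > 0" "norm z < 1"
  obtains D where "(lerch s has_field_derivative D) (at z)" "of_real s * lerch s z + z * D = 1 / (1 - z)"
proof -
  define c :: "nat \<Rightarrow> complex" where "c = (\<lambda>n. inverse (of_real (s + real n)))"
  have lerch_eq: "lerch s = (\<lambda>z. \<Sum>n. c n * z ^ n)" by (auto simp: lerch_def c_def field_simps)
  have sm: "summable (\<lambda>n. c n * z ^ n)" if "norm z < 1" for z
    using summable_lerch[OF assms(1) that] by (simp add: c_def)
  have D: "(lerch s has_field_derivative (\<Sum>n. diffs c n * z ^ n)) (at z)"
    unfolding lerch_eq using sm assms(2) by (rule termdiffs_strong')
  have "(\<lambda>n. of_nat n * c n * z ^ (n - Suc 0)) sums (\<Sum>n. diffs c n * z ^ n)"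
    using termdiff_converges[OF assms(2) sm] by (intro diffs_equiv)
  hence "(\<lambda>n. z * (of_nat n * c n * z ^ (n - Suc 0))) sums (z * (\<Sum>n. diffs c n * z ^ n))"
    by (rule sums_mult)
  hence "(\<lambda>n. of_real s * (c n * z ^ n) + z * (of_nat n * c n * z ^ (n - Suc 0))) sums
      (of_real s * lerch s z + z * (\<Sum>n. diffs c n * z ^ n))"
    unfolding lerch_eq using sums_add[OF sums_mult[OF summable_sums[OF sm[OF assms(2)]]]] by blast
  moreover have "of_real s * (c n * z ^ n) + z * (of_nat n * c n * z ^ (n - Suc 0)) = z ^ n" for n
  proof -
    have "of_real (s + real n) * c n = 1"
      unfolding c_def using assms(1) by (intro right_inverse) (simp del: of_real_add)
    hence "(of_real s + of_nat n) * c n = 1" by simp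
    moreover have "z * (of_nat n * c n * z ^ (n - Suc 0)) = of_nat n * c n * z ^ n"
      by (cases n) auto
    hence "of_real s * (c n * z ^ n) + z * (of_nat n * c n * z ^ (n - Suc 0)) =
        ((of_real s + of_nat n) * c n) * z ^ n"
      by (simp only: ring_distribs mult.assoc)
    ultimately show ?thesis by simp
  qed
  ultimately have "of_real s * lerch s z + z * (\<Sum>n. diffs c n * z ^ n) = 1 / (1 - z)"
    using geometric_sums[OF assms(2)] sums_unique2 by auto
  with D that show ?thesis by blast
qed

lemma extremal_zero [simp]: "s > 0 \<Longrightarrow> extremal s 0 = 1"
  using powser_zero[of "\<lambda>n. inverse (of_real (s + real n)) :: complex"]
  by (simp add: extremal_def lerch_def divide_inverse mult.commute)

lemma extremal_holomorphic: "s > 0 \<Longrightarrow> extremal s holomorphic_on ball 0 1"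
  unfolding extremal_def
  by (intro holomorphic_intros) (auto simp: holomorphic_on_open elim!: lerch_ode[of s] )

lemma extremal_ode:
  assumes "s > 0" "norm z < 1"
  shows "of_real s * extremal s z + z * deriv (extremal s) z = of_real s * ((1 + z) / (1 - z))"
proof -
  obtain D where D: "(lerch s has_field_derivative D) (at z)" "of_real s * lerch s z + z * D = 1 / (1 - z)"
    using lerch_ode[OF assms] .
  have "deriv (extremal s) z = 2 * of_real s * D"
    unfolding extremal_def by (rule DERIV_imp_deriv) (auto intro!: derivative_eq_intros D(1))
  hence "of_real s * extremal s z + z * deriv (extremal s) z = 2 * of_real s * (of_real s * lerch s z + z * D) - of_real s"
    by (simp add: extremal_def algebra_simps)
  also have "\<dots> = of_real s * ((1 + z) / (1 - z))"
  proof -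
    have "1 - z \<noteq> 0" using assms(2) by auto
    thus ?thesis unfolding D(2) by (simp add: divide_simps) (simp add: algebra_simps)
  qed
  finally show ?thesis .
qed

text \<open>
  Along a radius, \<open>x\<^sup>s F(x w)\<close> has derivative \<open>x\<^bsup>s-1\<^esup> (s F + z F')\<close>. By Harnack's inequality the real
  part of \<open>s F + z F'\<close> is at least its value at \<open>- norm z\<close> for \<open>t + (1 - t) extremal s\<close>, and this
  comparison of derivatives integrates to a comparison of \<open>Re F\<close>.
\<close>

lemma Re_ge_extremal:
  assumes s: "s > 0" and t: "t \<le> 1"
    and holF: "F holomorphic_on ball 0 1" and F0: "F 0 = 1"
    and h: "\<And>z. norm z < 1 \<Longrightarrow> Re (of_real s * F z + z * deriv F z) \<ge> s * t"
    and z: "norm z < 1"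
  shows "Re (F z) \<ge> t + (1 - t) * Re (extremal s (- of_real (norm z)))"
proof (cases "z = 0")
  case True
  thus ?thesis using F0 s by simp
next
  case False
  define w where "w = sgn z"
  have w: "norm w = 1" "of_real (norm z) * w = z"
    using False by (simp add: w_def norm_sgn) (use False in \<open>simp add: w_def sgn_div_norm scaleR_conv_of_real\<close>)
  have harnack: "Re (of_real s * F v + v * deriv F v) \<ge> s * t + (1 - t) * (s * ((1 - norm v) / (1 + norm v)))"
    if v: "norm v < 1" for v
  proof -
    have "Re ((of_real s * F v + v * deriv F v) - of_real (s * t))
        \<ge> (s * (1 - t)) * (1 - norm v) / (1 + norm v)"
      by (rule Re_ge_Harnack)
         (use h v F0 in \<open>auto intro!: holomorphic_intros holF simp: algebra_simps\<close>)
    thus ?thesis by (simp add: algebra_simps)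
  qed
  define D where "D = (\<lambda>x. Re (F (of_real x * w)) - t - (1 - t) * Re (extremal s (of_real x * - 1)))"
  define D' where "D' = (\<lambda>x. Re (deriv F (of_real x * w) * w) - (1 - t) * Re (deriv (extremal s) (of_real x * - 1) * - 1))"
  have derD: "(D has_real_derivative D' x) (at x)" if x: "0 \<le> x" "x < 1" for x
  proof -
    have ray: "((\<lambda>x. Re (G (of_real x * u))) has_real_derivative Re (deriv G (of_real x * u) * u)) (at x)"
      if "G holomorphic_on ball 0 1" "norm u = 1" for G u
    proof -
      have "(G has_field_derivative deriv G (of_real x * u)) (at (of_real x * u))"
        using x that by (intro holomorphic_derivI[OF that(1)]) (auto simp: norm_mult)
      moreover have "((\<lambda>x. of_real x * u) has_vector_derivative u) (at x)"
        by (auto intro!: derivative_eq_intros)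
      ultimately have "((G \<circ> (\<lambda>x. of_real x * u)) has_vector_derivative u * deriv G (of_real x * u)) (at x)"
        by (rule field_vector_diff_chain_at[rotated])
      thus ?thesis by (auto dest!: has_field_derivative_Re simp: o_def mult.commute)
    qed
    have "(D has_real_derivative Re (deriv F (of_real x * w) * w) - 0 -
        (1 - t) * Re (deriv (extremal s) (of_real x * - 1) * - 1)) (at x)"
      unfolding D_def
      by (intro DERIV_diff DERIV_cmult DERIV_const ray holF w(1) extremal_holomorphic[OF s]) simp
    thus ?thesis by (simp add: D'_def)
  qed
  have ineq: "x * D' x + s * D x \<ge> 0" if x: "0 < x" "x < 1" for x
  proof -
    have "Re (of_real s * extremal s (- of_real x) + (- of_real x) * deriv (extremal s) (- of_real x)) =
        s * ((1 - x) / (1 + x))"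
    proof -
      have "(1 + - of_real x) / (1 - - of_real x) = (of_real ((1 - x) / (1 + x)) :: complex)" by simp
      moreover have "norm (- of_real x :: complex) < 1" using x by simp
      ultimately show ?thesis using extremal_ode[OF s, of "- of_real x"] by (metis Re_complex_of_real of_real_mult)
    qed
    moreover have "x * D' x + s * D x = Re (of_real s * F (of_real x * w) + (of_real x * w) * deriv F (of_real x * w))
       - s * t - (1 - t) * Re (of_real s * extremal s (- of_real x) + (- of_real x) * deriv (extremal s) (- of_real x))"
      by (simp add: D_def D'_def algebra_simps)
    ultimately show ?thesis
      using harnack[of "of_real x * w"] x w(1) by (simp add: norm_mult)
  qed
  \<comment> \<open>Both sides of the comparison are weighted by \<open>x powr s\<close>, which vanishes at 0 because \<open>s > 0\<close>.\<close>
  have "0 powr s * D 0 \<le> norm z powr s * D (norm z)"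
  proof (rule DERIV_nonneg_imp_increasing_open[where f = "\<lambda>x. x powr s * D x"])
    show "\<exists>y. ((\<lambda>x. x powr s * D x) has_real_derivative y) (at x) \<and> 0 \<le> y"
      if x: "0 < x" "x < norm z" for x
    proof (intro exI conjI)
      show "((\<lambda>x. x powr s * D x) has_real_derivative x powr (s - 1) * (x * D' x + s * D x)) (at x)"
        using x z by (auto intro!: derivative_eq_intros derD simp: algebra_simps powr_diff)
      show "0 \<le> x powr (s - 1) * (x * D' x + s * D x)"
        using ineq[of x] x z by simp
    qed
    show "continuous_on {0..norm z} (\<lambda>x. x powr s * D x)"
      using z s derD by (intro continuous_intros continuous_on_powr' DERIV_continuous_on[where D=D'] )
        (auto intro: has_field_derivative_at_within)
  qed simp
  hence "D (norm z) \<ge> 0" using False s by (simp add: zero_le_mult_iff)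
  thus ?thesis using w(2) by (simp add: D_def)
qed

lemma Re_of_real_mult: "Re (of_real a * z) = a * Re z"
  by simp

lemma Re_cayley: "Re ((1 + v) / (1 - v)) = (1 - (norm v)\<^sup>2) / (norm (1 - v))\<^sup>2"
  by (simp add: Re_divide' cmod_power2) (simp add: power2_eq_square algebra_simps)

text \<open>
  Passing from \<open>s\<close> to \<open>s'\<close> adds \<open>(s' - s) F\<close> to \<open>s F + z F'\<close>, and the latter is explicit for the
  extremal function, so membership in another class becomes a concrete inequality. This is the
  source of all obstructions to inclusion below.
\<close>

lemma extremal_in_frakA_iff:
  assumes "s > 0" "0 \<le> s'" "t' \<le> 1"
  shows "(\<lambda>z. z * (of_real t + of_real (1 - t) * extremal s z)) \<in> frakA s' t' \<longleftrightarrow>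
    (\<forall>z. norm z < 1 \<longrightarrow> s * t + (1 - t) * (s * Re ((1 + z) / (1 - z))) +
        (s' - s) * (t + (1 - t) * Re (extremal s z)) \<ge> s' * t')"
proof -
  let ?F = "\<lambda>z. of_real t + of_real (1 - t) * extremal s z"
  have "Re (of_real s' * ?F z + z * deriv ?F z) = s * t + (1 - t) * (s * Re ((1 + z) / (1 - z))) +
        (s' - s) * (t + (1 - t) * Re (extremal s z))" if z: "norm z < 1" for z
  proof -
    have "(extremal s has_field_derivative deriv (extremal s) z) (at z)"
      using z by (intro holomorphic_derivI[OF extremal_holomorphic[OF assms(1)]]) auto
    hence "deriv ?F z = of_real (1 - t) * deriv (extremal s) z"
      by (intro DERIV_imp_deriv) (auto intro!: derivative_eq_intros)
    hence "of_real s' * ?F z + z * deriv ?F z = of_real (s * t) +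
        of_real (1 - t) * (of_real s * extremal s z + z * deriv (extremal s) z) + of_real (s' - s) * ?F z"
      by (simp only:) (simp add: algebra_simps)
    hence "of_real s' * ?F z + z * deriv ?F z = of_real (s * t) +
        of_real (1 - t) * (of_real s * ((1 + z) / (1 - z))) + of_real (s' - s) * ?F z"
      unfolding extremal_ode[OF assms(1) z] .
    thus ?thesis
      by (simp only: plus_complex.sel Re_complex_of_real Re_of_real_mult)
  qed
  moreover have "?F holomorphic_on ball 0 1"
    by (intro holomorphic_intros extremal_holomorphic assms(1))
  ultimately show ?thesis
    using assms frakA_iff[of ?F "\<lambda>z. z * ?F z" s' t'] by simp
qed

lemma extremal_in_frakA:
  assumes "s > 0" "t \<le> 1"
  shows "(\<lambda>z. z * (of_real t + of_real (1 - t) * extremal s z)) \<in> frakA s t"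
proof -
  have "0 \<le> (1 - t) * (s * Re ((1 + z) / (1 - z)))" if "norm z < 1" for z
    using that assms unfolding Re_cayley by (simp add: power_le_one)
  thus ?thesis using assms by (subst extremal_in_frakA_iff) auto
qed

text \<open>
  The extremal function decreases on the negative radius: its dilation \<open>z \<mapsto> extremal s (c z)\<close>
  still satisfies \<open>Re (s F + z F') \<ge> 0\<close>, so it is minorized by the extremal function itself.
  Hence the radial limit at -1, where it exists, is a lower bound.
\<close>

lemma extremal_ge_limit:
  assumes s: "s > 0" and lim: "((\<lambda>r. Re (extremal s (- of_real r))) \<longlongrightarrow> \<mu>) (at_left 1)"
    and r: "0 \<le> r" "r < 1"
  shows "\<mu> \<le> Re (extremal s (- of_real r))"
proof (rule tendsto_upperbound[OF lim])
  have "Re (extremal s (- of_real r')) \<le> Re (extremal s (- of_real r))" if r': "r < r'" "r' < 1" for r'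
  proof -
    define c where "c = r / r'"
    have c: "0 \<le> c" "c < 1" "c * r' = r" using r r' by (auto simp: c_def)
    have small: "norm (of_real c * z) < 1" if "norm z < 1" for z :: complex
      using c that mult_right_mono[of c 1 "norm z"] by (simp add: norm_mult)
    define F where "F = (\<lambda>z. extremal s (of_real c * z))"
    have derF: "(F has_field_derivative of_real c * deriv (extremal s) (of_real c * z)) (at z)"
      if "norm z < 1" for z
    proof -
      have "(extremal s has_field_derivative deriv (extremal s) (of_real c * z)) (at (of_real c * z))"
        using small[OF that] by (intro holomorphic_derivI[OF extremal_holomorphic[OF s]]) auto
      from DERIV_chain2[OF this DERIV_cmult[OF DERIV_ident]] show ?thesis
        by (simp add: F_def mult.commute)
    qed
    have "Re (F (- of_real r')) \<ge> 0 + (1 - 0) * Re (extremal s (- of_real (norm (- of_real r' :: complex))))"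
    proof (rule Re_ge_extremal[OF s])
      show "F holomorphic_on ball 0 1" using derF by (force simp: holomorphic_on_open)
      show "F 0 = 1" using s by (simp add: F_def)
      fix z :: complex assume z: "norm z < 1"
      have "of_real s * F z + z * deriv F z = of_real s * ((1 + of_real c * z) / (1 - of_real c * z))"
        using extremal_ode[OF s small[OF z]] DERIV_imp_deriv[OF derF[OF z]]
        by (simp add: F_def mult_ac)
      also have "Re \<dots> = s * Re ((1 + of_real c * z) / (1 - of_real c * z))"
        by (rule Re_of_real_mult)
      also have "\<dots> \<ge> 0"
        using s small[OF z] unfolding Re_cayley by (simp add: power_le_one)
      finally show "s * 0 \<le> Re (of_real s * F z + z * deriv F z)" by simp
    qed (use r r' in auto)
    thus ?thesis using r r' c(3) by (simp add: F_def flip: of_real_mult)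
  qed
  thus "\<forall>\<^sub>F r' in at_left 1. Re (extremal s (- of_real r')) \<le> Re (extremal s (- of_real r))"
    using r by (auto simp: eventually_at_left[of r])
qed simp

section \<open>The inclusion order\<close>

text \<open>
  Writing \<open>\<tau> = 1 - t\<close>, the lower bounds \<open>s t\<close> for \<open>Re (s F + z F')\<close> and \<open>t + \<tau> \<mu>\<close> for \<open>Re F\<close> add up
  to a lower bound for \<open>Re (s' F + z F')\<close>; the hypothesis says that it is at least \<open>s' t'\<close>. The
  extremal function approaches both bounds simultaneously at -1, which makes the criterion sharp.
\<close>

lemma frakA_subset:
  assumes "0 < s" "s \<le> s'" "t \<le> 1" "t' \<le> 1"
    and lim: "((\<lambda>r. Re (extremal s (- of_real r))) \<longlongrightarrow> \<mu>) (at_left 1)"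
    and le: "(1 - t) * (s + (s' - s) * (1 - \<mu>)) \<le> s' * (1 - t')"
  shows "frakA s t \<subseteq> frakA s' t'"
proof
  fix f assume f: "f \<in> frakA s t"
  then obtain F where F: "F holomorphic_on ball 0 1" "\<And>z. norm z < 1 \<Longrightarrow> f z = z * F z"
    using frakA_quotient by blast
  from f have F0: "F 0 = 1" and h: "\<And>z. norm z < 1 \<Longrightarrow> s * t \<le> Re (of_real s * F z + z * deriv F z)"
    using frakA_iff[OF F, of s t] assms by auto
  have "s' * t' \<le> Re (of_real s' * F z + z * deriv F z)" if z: "norm z < 1" for z
  proof -
    have "t + (1 - t) * \<mu> \<le> t + (1 - t) * Re (extremal s (- of_real (norm z)))"
      using extremal_ge_limit[OF assms(1) lim, of "norm z"] z assms(3) by (simp add: mult_left_mono)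
    also have "\<dots> \<le> Re (F z)"
      using Re_ge_extremal[OF assms(1,3) F(1) F0 h z] by simp
    finally have "(s' - s) * (t + (1 - t) * \<mu>) \<le> (s' - s) * Re (F z)"
      using assms(2) by (simp add: mult_left_mono)
    hence "s * t + (s' - s) * (t + (1 - t) * \<mu>) \<le> Re (of_real s' * F z + z * deriv F z)"
      using h[OF z] by (simp add: algebra_simps)
    moreover have "s * t + (s' - s) * (t + (1 - t) * \<mu>) = s' - (1 - t) * (s + (s' - s) * (1 - \<mu>))"
      by (simp add: algebra_simps)
    ultimately show ?thesis using le by (simp add: algebra_simps)
  qed
  thus "f \<in> frakA s' t'"
    using frakA_iff[OF F, of s' t'] F0 assms by auto
qed

text \<open>
  The extremal member of the smaller class, evaluated at \<open>- r\<close> with \<open>r\<close> tending to 1.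
\<close>

lemma frakA_subset_imp:
  assumes "0 < s" "0 \<le> s'" "t \<le> 1" "t' \<le> 1"
    and lim: "((\<lambda>r. Re (extremal s (- of_real r))) \<longlongrightarrow> \<mu>) (at_left 1)"
    and sub: "frakA s t \<subseteq> frakA s' t'"
  shows "(1 - t) * (s + (s' - s) * (1 - \<mu>)) \<le> s' * (1 - t')"
proof -
  have *: "s' * t' \<le> s * t + (1 - t) * (s * Re ((1 + z) / (1 - z))) + (s' - s) * (t + (1 - t) * Re (extremal s z))"
    if "norm z < 1" for z
    using extremal_in_frakA[OF assms(1,3)] extremal_in_frakA_iff[OF assms(1,2,4), of t] sub that by blast
  have "s' * t' \<le> s * t + (1 - t) * (s * ((1 - 1) / (1 + 1))) + (s' - s) * (t + (1 - t) * \<mu>)"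
  proof (rule tendsto_lowerbound[where F = "at_left 1"])
    show "((\<lambda>r. s * t + (1 - t) * (s * ((1 - r) / (1 + r))) + (s' - s) * (t + (1 - t) * Re (extremal s (- of_real r))))
      \<longlongrightarrow> s * t + (1 - t) * (s * ((1 - 1) / (1 + 1))) + (s' - s) * (t + (1 - t) * \<mu>)) (at_left 1)"
      by (intro tendsto_intros lim) auto
    show "\<forall>\<^sub>F r in at_left 1. s' * t' \<le> s * t + (1 - t) * (s * ((1 - r) / (1 + r))) + (s' - s) * (t + (1 - t) * Re (extremal s (- of_real r)))"
      unfolding eventually_at_left[of 0 "1::real", simplified]
    proof (intro exI[of _ 0] conjI allI impI)
      fix r :: real assume r: "0 < r" "r < 1"
      have "(1 + - of_real r) / (1 - - of_real r) = (of_real ((1 - r) / (1 + r)) :: complex)" by simp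
      thus "s' * t' \<le> s * t + (1 - t) * (s * ((1 - r) / (1 + r))) + (s' - s) * (t + (1 - t) * Re (extremal s (- of_real r)))"
        using *[of "- of_real r"] r by (metis Re_complex_of_real abs_of_pos norm_minus_cancel norm_of_real)
    qed simp
  qed simp
  thus ?thesis by (simp add: algebra_simps)
qed

text \<open>
  The coefficients \<open>1 / (s + n)\<close> and \<open>1 / n\<close> differ by \<open>O(1 / n\<^sup>2)\<close>, so the singularity at 1 is
  logarithmic.
\<close>

lemma lerch_plus_ln_bounded:
  assumes "s > 0"
  obtains C where "\<And>z. norm z < 1 \<Longrightarrow> norm (lerch s z + ln (1 - z)) \<le> C"
proof -
  \<comment> \<open>At \<open>n = 0\<close> division by zero makes the logarithmic term vanish, which leaves \<open>1 / s\<close>.\<close>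
  define M where "M = (\<lambda>n. (if n = 0 then 1 / s else 0) + s * (1 / (real n)\<^sup>2))"
  have M: "summable M"
    unfolding M_def using inverse_power_summable[of 2, where ?'a = real]
    by (intro summable_add summable_mult) (auto simp: inverse_eq_divide)
  have "norm (lerch s z + ln (1 - z)) \<le> suminf M" if z: "norm z < 1" for z
  proof -
    let ?g = "\<lambda>n. z ^ n / of_real (s + real n) - z ^ n / of_nat n"
    have 1: "(\<lambda>n. - (z ^ n) / of_nat n) sums ln (1 - z)"
      using Ln_series'[of "- z"] z by simp
    have "(\<lambda>n. z ^ n / of_real (s + real n)) sums lerch s z"
      using summable_sums[OF summable_lerch[OF assms z]]
      by (simp add: lerch_def divide_inverse mult.commute)
    from sums_add[OF this 1] have sg: "?g sums (lerch s z + ln (1 - z))" by simp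
    have nb: "norm (?g n) \<le> M n" for n
    proof (cases "n = 0")
      case True
      thus ?thesis using assms by (simp add: M_def norm_divide)
    next
      case False
      have "?g n = z ^ n * of_real (1 / (s + real n) - 1 / real n)" by (simp add: algebra_simps)
      also have "norm \<dots> = norm z ^ n * \<bar>1 / (s + real n) - 1 / real n\<bar>"
        unfolding norm_mult norm_power norm_of_real ..
      also have "\<dots> \<le> 1 * \<bar>1 / (s + real n) - 1 / real n\<bar>"
        using z by (intro mult_right_mono) (auto simp: power_le_one)
      also have "1 / (s + real n) - 1 / real n = - (s / ((s + real n) * real n))"
        using False assms by (simp add: divide_simps)
      also have "1 * \<bar>- (s / ((s + real n) * real n))\<bar> = s / ((s + real n) * real n)"
        using assms by simp
      also have "\<dots> \<le> s / (real n * real n)"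
        using assms False by (intro divide_left_mono mult_right_mono) auto
      finally show ?thesis using False by (simp add: M_def power2_eq_square)
    qed
    have "summable (\<lambda>n. norm (?g n))"
      by (rule summable_comparison_test[OF _ M]) (use nb in auto)
    hence "norm (suminf ?g) \<le> suminf M"
      using summable_norm[of ?g] suminf_le[OF nb _ M] by linarith
    thus ?thesis using sums_unique[OF sg] by simp
  qed
  thus ?thesis using that by blast
qed

text \<open>
  The index cannot drop. For \<open>s' < s\<close> the condition for the extremal function reads
  \<open>Re (s F + z F') - (s - s') Re F \<ge> s' t'\<close>. On the horocycle where \<open>Re ((1 + z) / (1 - z)) = 1\<close> the
  first term stays constant while \<open>Re F\<close> grows logarithmically as \<open>z\<close> tends to 1.
\<close>

lemma frakA_subset_imp_index_le:
  assumes "0 < s" "0 \<le> t" "t < 1" "0 \<le> s'" "0 \<le> t'" "t' \<le> 1"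
    and sub: "frakA s t \<subseteq> frakA s' t'"
  shows "s \<le> s'"
proof (rule ccontr)
  assume "\<not> s \<le> s'"
  hence ss: "s' < s" by simp
  obtain C where C: "\<And>z. norm z < 1 \<Longrightarrow> norm (lerch s z + ln (1 - z)) \<le> C"
    using lerch_plus_ln_bounded[OF assms(1)] by blast
  define B where "B = (1 + s / ((s - s') * (1 - t))) / (2 * s)"
  have bound: "- ln (norm (2 / (2 + \<i> * of_real y))) \<le> C + B" for y :: real
  proof -
    \<comment> \<open>The inverse of \<open>(1 + z) / (1 - z)\<close> parametrizes the horocycle by the line \<open>Re w = 1\<close>.\<close>
    define w where "w = 1 + \<i> * of_real y"
    define z where "z = (w - 1) / (w + 1)"
    have w1: "w + 1 = 2 + \<i> * of_real y" "w + 1 \<noteq> 0" by (auto simp: w_def complex_eq_iff)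
    have z1: "1 - z = 2 / (2 + \<i> * of_real y)" using w1 by (simp add: z_def field_simps)
    have wz: "(1 + z) / (1 - z) = w" using w1(2) by (simp add: z_def divide_simps)
    have "norm (w - 1) < norm (w + 1)"
      unfolding cmod_def by (rule real_sqrt_less_mono) (simp add: w_def)
    hence z: "norm z < 1" using w1(2) by (simp add: z_def norm_divide)
    have nz: "1 - z \<noteq> 0" using z by auto
    have "s' * t' \<le> s * t + (1 - t) * (s * Re ((1 + z) / (1 - z))) + (s' - s) * (t + (1 - t) * Re (extremal s z))"
      using extremal_in_frakA[of s t] extremal_in_frakA_iff[of s s' t' t] assms z by auto
    moreover have "0 \<le> s' * t'" "0 \<le> (s - s') * t" using assms ss by auto
    ultimately have "(s - s') * (1 - t) * Re (extremal s z) \<le> s"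
      unfolding wz by (simp add: w_def algebra_simps)
    hence "Re (extremal s z) \<le> s / ((s - s') * (1 - t))"
      using ss assms by (simp add: pos_le_divide_eq mult_ac)
    hence "Re (lerch s z) \<le> B"
      using assms(1) by (simp add: extremal_def B_def pos_le_divide_eq mult_ac)
    moreover have "Re (lerch s z + ln (1 - z)) \<ge> - C"
      using C[OF z] abs_Re_le_cmod[of "lerch s z + ln (1 - z)"] by simp
    ultimately show ?thesis using nz by (simp flip: z1)
  qed
  have "(\<lambda>y::real. - ln (norm (2 / (2 + \<i> * of_real y)))) = (\<lambda>y. - ln (2 / sqrt (4 + y\<^sup>2)))"
    unfolding norm_divide by (simp add: cmod_def)
  moreover have "filterlim (\<lambda>y::real. - ln (2 / sqrt (4 + y\<^sup>2))) at_top at_top"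
    by real_asymp
  ultimately have "filterlim (\<lambda>y::real. - ln (norm (2 / (2 + \<i> * of_real y)))) at_top at_top"
    by simp
  hence "\<forall>\<^sub>F y in at_top. C + B < - ln (norm (2 / (2 + \<i> * of_real y)))"
    by (simp add: filterlim_at_top_dense)
  thus False using bound by (auto simp: eventually_at_top_linorder not_less[symmetric])
qed

section \<open>Failure of the lattice property\<close>

text \<open>
  For integral \<open>s\<close> the series is a shifted logarithm series, which gives the radial limits at -1.
\<close>

lemma lerch_1: "norm z < 1 \<Longrightarrow> z * lerch 1 z = - ln (1 - z)"
  and lerch_2: "norm z < 1 \<Longrightarrow> z\<^sup>2 * lerch 2 z = - ln (1 - z) - z"
proof -
  assume z: "norm z < 1"
  have series: "(\<lambda>n. z ^ n / of_real (s + real n)) sums lerch s z" if "s > 0" for s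
    using summable_sums[OF summable_lerch[OF that z]]
    by (simp add: lerch_def divide_inverse mult.commute)
  have ser: "(\<lambda>n. z ^ n / of_nat n) sums (- ln (1 - z))"
    using sums_minus[OF Ln_series'[of "- z"]] z by simp
  hence 1: "(\<lambda>n. z ^ Suc n / of_nat (Suc n)) sums (- ln (1 - z))"
    by (subst sums_Suc_iff) simp
  show "z * lerch 1 z = - ln (1 - z)"
    by (rule sums_unique2[OF _ 1]) (use sums_mult[OF series[of 1], of z] in \<open>simp add: add_ac\<close>)
  have 2: "(\<lambda>n. z ^ Suc (Suc n) / of_nat (Suc (Suc n))) sums (- ln (1 - z) - z)"
    using 1 by (subst sums_Suc_iff) simp
  show "z\<^sup>2 * lerch 2 z = - ln (1 - z) - z"
    by (rule sums_unique2[OF _ 2]) (use sums_mult[OF series[of 2], of "z\<^sup>2"] in \<open>simp add: add_ac power2_eq_square mult_ac\<close>)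
qed

lemma extremal_limits:
  shows "((\<lambda>r. Re (extremal 1 (- of_real r))) \<longlongrightarrow> 2 * ln 2 - 1) (at_left 1)"
    and "((\<lambda>r. Re (extremal 2 (- of_real r))) \<longlongrightarrow> 3 - 4 * ln 2) (at_left 1)"
proof -
  have Ln: "ln (1 - - of_real r :: complex) = of_real (ln (1 + r))" if "0 < r" for r :: real
    using that Ln_of_real[of "1 + r"] by simp
  have ev: "\<forall>\<^sub>F r in at_left 1. 0 < r \<and> r < (1::real)"
    by (subst eventually_at_left[of 0]) (auto intro: exI[of _ 0])
  have E1: "Re (extremal 1 (- of_real r)) = 2 * (ln (1 + r) / r) - 1" if r: "0 < r" "r < 1" for r
  proof -
    have "lerch 1 (- of_real r) = of_real (ln (1 + r) / r)"
      using lerch_1[of "- of_real r"] r Ln[OF r(1)] by (simp add: nonzero_eq_divide_eq mult.commute)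
    thus ?thesis by (simp add: extremal_def)
  qed
  have E2: "Re (extremal 2 (- of_real r)) = 4 * ((r - ln (1 + r)) / r\<^sup>2) - 1" if r: "0 < r" "r < 1" for r
  proof -
    have "lerch 2 (- of_real r) = of_real ((r - ln (1 + r)) / r\<^sup>2)"
      using lerch_2[of "- of_real r"] r Ln[OF r(1)] by (simp add: nonzero_eq_divide_eq mult.commute)
    thus ?thesis by (simp add: extremal_def)
  qed
  have "((\<lambda>r. 2 * (ln (1 + r) / r) - 1) \<longlongrightarrow> 2 * (ln (1 + 1) / 1) - 1) (at_left (1::real))"
    by (intro tendsto_intros) auto
  hence "((\<lambda>r. Re (extremal 1 (- of_real r))) \<longlongrightarrow> 2 * (ln (1 + 1) / 1) - 1) (at_left 1)"
    by (rule Lim_transform_eventually) (use ev E1 in \<open>auto elim!: eventually_mono\<close>)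
  thus "((\<lambda>r. Re (extremal 1 (- of_real r))) \<longlongrightarrow> 2 * ln 2 - 1) (at_left 1)" by simp
  have "((\<lambda>r. 4 * ((r - ln (1 + r)) / r\<^sup>2) - 1) \<longlongrightarrow> 4 * ((1 - ln (1 + 1)) / 1\<^sup>2) - 1) (at_left (1::real))"
    by (intro tendsto_intros) auto
  hence "((\<lambda>r. Re (extremal 2 (- of_real r))) \<longlongrightarrow> 4 * ((1 - ln (1 + 1)) / 1\<^sup>2) - 1) (at_left 1)"
    by (rule Lim_transform_eventually) (use ev E2 in \<open>auto elim!: eventually_mono\<close>)
  thus "((\<lambda>r. Re (extremal 2 (- of_real r))) \<longlongrightarrow> 3 - 4 * ln 2) (at_left 1)" by simp
qed

theorem corollary4p5:
  shows "\<not> lattice (inclusion_order frakA_family)"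
proof
  assume lat: "lattice (inclusion_order frakA_family)"
  \<comment> \<open>The smaller root of the quadratic is \<open>(5 - sqrt 5) / 4 = 0.69098...\<close>, just below \<open>ln 2 = 0.69314...\<close>.\<close>
  define L where "L = ln (2::real)"
  have L: "4 * L\<^sup>2 - 10 * L + 5 < 0" "691/1000 < L" "L \<le> 25/36"
  proof -
    show 1: "691/1000 < L" unfolding L_def
      using ln_approx_bounds[of 2 2] by (simp add: eval_nat_numeral)
    show 2: "L \<le> 25/36" unfolding L_def by (rule ln2_le_25_over_36)
    have "(L - 691/1000) * (L - 7/10) \<le> 0" using 1 2 by (intro mult_nonneg_nonpos) auto
    moreover have "(L - 691/1000) * (L - 7/10) = L * L - 1391/1000 * L + 4837/10000"
      by (simp add: field_simps)
    ultimately have "L * L \<le> 1391/1000 * L - 4837/10000" by linarith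
    thus "4 * L\<^sup>2 - 10 * L + 5 < 0" using 1 unfolding power2_eq_square by linarith
  qed
  note lim = extremal_limits[folded L_def]
  \<comment> \<open>The values \<open>u2\<close> and \<open>u3\<close> are the largest ones for which \<open>frakA 1 0\<close> is contained in \<open>frakA 2 u2\<close>
      and \<open>frakA 3 u3\<close>; \<open>t2\<close> is the smallest one for which \<open>frakA 2 t2\<close> is contained in \<open>frakA 3 u3\<close>.\<close>
  define t2 u2 u3 where "t2 = 1 - (5 - 4 * L) / (4 * L)" and "u2 = 1 - (3 - 2 * L) / 2"
    and "u3 = 1 - (5 - 4 * L) / 3"
  have t2: "0 \<le> t2" "t2 < 1" and u2: "0 \<le> u2" "u2 \<le> 1" and u3: "0 \<le> u3" "u3 \<le> 1"
    using L(2,3) by (auto simp: t2_def u2_def u3_def field_simps)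
  have fam: "frakA s t \<in> frakA_family" if "0 \<le> s" "0 \<le> t" "t \<le> 1" for s t
    using that by (auto simp: frakA_family_def)
  have "\<exists>!S. S \<in> frakA_family \<and> frakA 1 0 \<union> frakA 2 t2 \<subseteq> S \<and>
      (\<forall>T\<in>frakA_family. frakA 1 0 \<union> frakA 2 t2 \<subseteq> T \<longrightarrow> S \<subseteq> T)"
    using lat fam[of 1 0] fam[of 2 t2] t2 unfolding lattice_inclusion_order_iff by simp
  then obtain S where S: "S \<in> frakA_family" "frakA 1 0 \<subseteq> S" "frakA 2 t2 \<subseteq> S"
    and least: "\<And>T. T \<in> frakA_family \<Longrightarrow> frakA 1 0 \<subseteq> T \<Longrightarrow> frakA 2 t2 \<subseteq> T \<Longrightarrow> S \<subseteq> T"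
    by (meson Un_subset_iff)
  then obtain s t where st: "S = frakA s t" "0 \<le> s" "0 \<le> t" "t \<le> 1"
    by (auto simp: frakA_family_def)
  have "S \<subseteq> frakA 2 u2"
  proof (rule least)
    show "frakA 1 0 \<subseteq> frakA 2 u2"
      by (rule frakA_subset[OF _ _ _ _ lim(1)]) (use u2 in \<open>auto simp: u2_def\<close>)
    have "(5 - 4 * L) / (4 * L) \<le> (3 - 2 * L) / 2"
      using L by (simp add: field_simps power2_eq_square)
    hence "1 - t2 \<le> 1 - u2" by (simp add: t2_def u2_def)
    thus "frakA 2 t2 \<subseteq> frakA 2 u2"
      by (intro frakA_subset[OF _ _ _ _ lim(2)]) (use u2 t2 in simp_all)
  qed (use fam u2 in auto)
  have "S \<subseteq> frakA 3 u3"
  proof (rule least)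
    show "frakA 1 0 \<subseteq> frakA 3 u3"
      by (rule frakA_subset[OF _ _ _ _ lim(1)]) (use u3 in \<open>auto simp: u3_def\<close>)
    show "frakA 2 t2 \<subseteq> frakA 3 u3"
      using L by (intro frakA_subset[OF _ _ _ _ lim(2)]) (use u3 t2 in \<open>auto simp: u3_def t2_def field_simps\<close>)
  qed (use fam u3 in auto)
  \<comment> \<open>The two upper bounds force contradictory parameters on the supremum.\<close>
  have "2 \<le> s" using frakA_subset_imp_index_le[of 2 t2 s t] S(3) st t2 by simp
  have "t < 1"
  proof -
    have "(1 - t2) * (2 + (s - 2) * (1 - (3 - 4 * L))) \<le> s * (1 - t)"
      using frakA_subset_imp[OF _ _ _ _ lim(2), of s t2 t] S(3) st t2 by simp
    moreover have "(1 - t2) * (2 + (s - 2) * (1 - (3 - 4 * L))) > 0"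
      using t2 \<open>2 \<le> s\<close> L by (intro mult_pos_pos add_pos_nonneg mult_nonneg_nonneg) auto
    ultimately show ?thesis using st by (auto simp: less_le)
  qed
  have "s \<le> 2"
    using frakA_subset_imp_index_le[of s t 2 u2] \<open>S \<subseteq> frakA 2 u2\<close> st u2 \<open>2 \<le> s\<close> \<open>t < 1\<close> by simp
  hence s: "s = 2" using \<open>2 \<le> s\<close> by simp
  have 1: "3 - 2 * L \<le> 2 * (1 - t)"
    using frakA_subset_imp[OF _ _ _ _ lim(1), of 2 0 t] S(2) st s by simp
  have "(1 - t) * (4 * L) \<le> 5 - 4 * L"
    using frakA_subset_imp[OF _ _ _ _ lim(2), of 3 t u3] \<open>S \<subseteq> frakA 3 u3\<close> st s u3
    by (simp add: u3_def)
  moreover have "(3 - 2 * L) * (2 * L) \<le> 2 * (1 - t) * (2 * L)"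
    using 1 L by (intro mult_right_mono) auto
  ultimately show False using L(1) by (simp add: power2_eq_square algebra_simps)
qed

end
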